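(* Let $\varphi(x;z)$ and $\tilde\varphi(x;z)$ be stably separated formulas and let $\mathcal{D},\tilde{\mathcal{D}}\subseteq\mathcal{U}^{|z|}$ be finitely separated by $\varphi,\tilde\varphi$. Then for some $m,n<\omega$ the sets $\mathcal{D},\tilde{\mathcal{D}}$ are honestly finitely separated by $\psi,\tilde\psi$, where $\psi(\langle x_{i,j}\rangle_{i\le m,j\le n};z)=\bigwedge_{i=0}^m\bigvee_{j=0}^n\varphi(x_{i,j};z)$ and $\tilde\psi(\langle x_{i,j}\rangle_{i\le m,j\le n};z)=\bigvee_{i=0}^m\bigwedge_{j=0}^n\tilde\varphi(x_{i,j};z)$.
   Context: $\mathcal{U}$ is a structure for a first-order language $\mathcal{L}$ (in the paper, the monster model of the positive setting; no saturation is used), and $\varphi(x;z),\tilde\varphi(x;z)$ are arbitrary $\mathcal{L}$-formulas, $x,z$ finite tuples of variables. For a formula $\chi(x;z)$ and $a\in\mathcal{U}^{|x|}$, $\chi(a;\mathcal{U})=\{b\in\mathcal{U}^{|z|}:\mathcal{U}\models\chi(a;b)\}$. $\varphi,\tilde\varphi$ are stably separated if for some $n<\omega$ there is no sequence $\langle a_i;b_i:i<n\rangle$ with $\mathcal{U}\models\varphi(a_i;b_j)\wedge\tilde\varphi(a_j;b_i)$ for all $i<j<n$. Sets $\mathcal{D},\tilde{\mathcal{D}}\subseteq\mathcal{U}^{|z|}$ are finitely separated by $\varphi,\tilde\varphi$ if for every finite $B\subseteq\mathcal{U}^{|z|}$ there is $a\in\mathcal{U}^{|x|}$ with (ii) $B\cap\mathcal{D}\subseteq\varphi(a;\mathcal{U})$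 and (iii) $B\cap\tilde{\mathcal{D}}\subseteq\tilde\varphi(a;\mathcal{U})$. They are honestly finitely separated if $a$ can moreover be chosen so that (iv) $\mathcal{D}\cap\tilde\varphi(a;\mathcal{U})=\emptyset$ and (v) $\tilde{\mathcal{D}}\cap\varphi(a;\mathcal{U})=\emptyset$. These notions apply to any pair of formulas in place of $\varphi,\tilde\varphi$ (with the tuple of variables $x$ replaced accordingly). *)

theory Defs
  imports Main "HOL-Library.FuncSet"
begin

text \<open>
  First-order syntax in locally nameless style: \<open>Free\<close> variables are drawn from an arbitrary type,
  bound variables are de Bruijn indices, so that renaming free variables cannot capture.
\<close>

datatype ('f, 'v) fo_term =
    Free 'v
  | Bound nat
  | App 'f "('f, 'v) fo_term list"

datatype ('f, 'r, 'v) fo_formula =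
    Falsum
  | Equal "('f, 'v) fo_term" "('f, 'v) fo_term"
  | Rel 'r "('f, 'v) fo_term list"
  | Neg "('f, 'r, 'v) fo_formula"
  | And "('f, 'r, 'v) fo_formula" "('f, 'r, 'v) fo_formula"
  | Or "('f, 'r, 'v) fo_formula" "('f, 'r, 'v) fo_formula"
  | Imp "('f, 'r, 'v) fo_formula" "('f, 'r, 'v) fo_formula"
  | All "('f, 'r, 'v) fo_formula"
  | Ex "('f, 'r, 'v) fo_formula"

text \<open>A language is the set of its function symbols and the set of its relation symbols, each
  paired with its arity; constants are function symbols of arity 0.\<close>

record ('f, 'r) language =
  funs :: "('f \<times> nat) set"
  rels :: "('r \<times> nat) set"

record ('f, 'r, 'u) struct =
  univ :: "'u set"
  fun_int :: "'f \<Rightarrow> 'u list \<Rightarrow> 'u"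
  rel_int :: "'r \<Rightarrow> 'u list \<Rightarrow> bool"

definition is_structure :: "('f, 'r) language \<Rightarrow> ('f, 'r, 'u) struct \<Rightarrow> bool" where
  "is_structure L U \<longleftrightarrow> univ U \<noteq> {} \<and>
     (\<forall>(f, k) \<in> funs L. \<forall>us. length us = k \<and> set us \<subseteq> univ U \<longrightarrow> fun_int U f us \<in> univ U)"

text \<open>In \<open>wf_term L V k\<close> and \<open>wf_formula L V k\<close>, \<open>V\<close> is the set of admissible free variables and
  \<open>k\<close> the number of enclosing quantifiers.\<close>

fun wf_term :: "('f, 'r) language \<Rightarrow> 'v set \<Rightarrow> nat \<Rightarrow> ('f, 'v) fo_term \<Rightarrow> bool" where
  "wf_term L V k (Free v) \<longleftrightarrow> v \<in> V"
| "wf_term L V k (Bound i) \<longleftrightarrow> i < k"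
| "wf_term L V k (App f ts) \<longleftrightarrow> (f, length ts) \<in> funs L \<and> (\<forall>t \<in> set ts. wf_term L V k t)"

fun wf_formula :: "('f, 'r) language \<Rightarrow> 'v set \<Rightarrow> nat \<Rightarrow> ('f, 'r, 'v) fo_formula \<Rightarrow> bool" where
  "wf_formula L V k Falsum \<longleftrightarrow> True"
| "wf_formula L V k (Equal s t) \<longleftrightarrow> wf_term L V k s \<and> wf_term L V k t"
| "wf_formula L V k (Rel r ts) \<longleftrightarrow> (r, length ts) \<in> rels L \<and> (\<forall>t \<in> set ts. wf_term L V k t)"
| "wf_formula L V k (Neg p) \<longleftrightarrow> wf_formula L V k p"
| "wf_formula L V k (And p q) \<longleftrightarrow> wf_formula L V k p \<and> wf_formula L V k q"
| "wf_formula L V k (Or p q) \<longleftrightarrow> wf_formula L V k p \<and> wf_formula L V k q"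
| "wf_formula L V k (Imp p q) \<longleftrightarrow> wf_formula L V k p \<and> wf_formula L V k q"
| "wf_formula L V k (All p) \<longleftrightarrow> wf_formula L V (Suc k) p"
| "wf_formula L V k (Ex p) \<longleftrightarrow> wf_formula L V (Suc k) p"

fun term_val :: "('f, 'r, 'u) struct \<Rightarrow> ('v \<Rightarrow> 'u) \<Rightarrow> 'u list \<Rightarrow> ('f, 'v) fo_term \<Rightarrow> 'u" where
  "term_val U v e (Free x) = v x"
| "term_val U v e (Bound i) = e ! i"
| "term_val U v e (App f ts) = fun_int U f (map (term_val U v e) ts)"

fun sat :: "('f, 'r, 'u) struct \<Rightarrow> ('v \<Rightarrow> 'u) \<Rightarrow> 'u list \<Rightarrow> ('f, 'r, 'v) fo_formula \<Rightarrow> bool" where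
  "sat U v e Falsum \<longleftrightarrow> False"
| "sat U v e (Equal s t) \<longleftrightarrow> term_val U v e s = term_val U v e t"
| "sat U v e (Rel r ts) \<longleftrightarrow> rel_int U r (map (term_val U v e) ts)"
| "sat U v e (Neg p) \<longleftrightarrow> \<not> sat U v e p"
| "sat U v e (And p q) \<longleftrightarrow> sat U v e p \<and> sat U v e q"
| "sat U v e (Or p q) \<longleftrightarrow> sat U v e p \<or> sat U v e q"
| "sat U v e (Imp p q) \<longleftrightarrow> (sat U v e p \<longrightarrow> sat U v e q)"
| "sat U v e (All p) \<longleftrightarrow> (\<forall>u \<in> univ U. sat U v (u # e) p)"
| "sat U v e (Ex p) \<longleftrightarrow> (\<exists>u \<in> univ U. sat U v (u # e) p)"

text \<open>
  In a partitioned formula \<open>\<chi>(x;z)\<close> the tuples of variables \<open>x\<close> and \<open>z\<close> are indexed by sets \<open>X\<close>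
  and \<open>Z\<close>: the free variables are \<open>Inl i\<close> with \<open>i \<in> X\<close> and \<open>Inr k\<close> with \<open>k \<in> Z\<close>. Elements of
  \<open>\<U>\<^sup>|\<^sup>x\<^sup>|\<close> are the extensional functions from \<open>X\<close> to the universe, so tuples of length 0 are included.
\<close>

definition is_formula ::
    "('f, 'r) language \<Rightarrow> 'x set \<Rightarrow> 'z set \<Rightarrow> ('f, 'r, 'x + 'z) fo_formula \<Rightarrow> bool" where
  "is_formula L X Z \<chi> \<longleftrightarrow> wf_formula L (X <+> Z) 0 \<chi>"

definition tuples :: "('f, 'r, 'u) struct \<Rightarrow> 'i set \<Rightarrow> ('i \<Rightarrow> 'u) set" where
  "tuples U I = (I \<rightarrow>\<^sub>E univ U)"

definition holds ::
    "('f, 'r, 'u) struct \<Rightarrow> ('f, 'r, 'x + 'z) fo_formula \<Rightarrow> ('x \<Rightarrow> 'u) \<Rightarrow> ('z \<Rightarrow> 'u) \<Rightarrow> bool" where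
  "holds U \<chi> a b \<longleftrightarrow> sat U (case_sum a b) [] \<chi>"

definition fibre ::
    "('f, 'r, 'u) struct \<Rightarrow> 'z set \<Rightarrow> ('f, 'r, 'x + 'z) fo_formula \<Rightarrow> ('x \<Rightarrow> 'u) \<Rightarrow> ('z \<Rightarrow> 'u) set" where
  "fibre U Z \<chi> a = {b \<in> tuples U Z. holds U \<chi> a b}"

definition stably_separated ::
    "('f, 'r, 'u) struct \<Rightarrow> 'x set \<Rightarrow> 'z set \<Rightarrow>
     ('f, 'r, 'x + 'z) fo_formula \<Rightarrow> ('f, 'r, 'x + 'z) fo_formula \<Rightarrow> bool" where
  "stably_separated U X Z \<phi> \<phi>' \<longleftrightarrow>
     (\<exists>n::nat. \<not> (\<exists>a b. (\<forall>i<n. a i \<in> tuples U X \<and> b i \<in> tuples U Z) \<and>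
        (\<forall>i j. i < j \<and> j < n \<longrightarrow> holds U \<phi> (a i) (b j) \<and> holds U \<phi>' (a j) (b i))))"

definition finitely_separated ::
    "('f, 'r, 'u) struct \<Rightarrow> 'x set \<Rightarrow> 'z set \<Rightarrow>
     ('f, 'r, 'x + 'z) fo_formula \<Rightarrow> ('f, 'r, 'x + 'z) fo_formula \<Rightarrow>
     ('z \<Rightarrow> 'u) set \<Rightarrow> ('z \<Rightarrow> 'u) set \<Rightarrow> bool" where
  "finitely_separated U X Z \<phi> \<phi>' D D' \<longleftrightarrow>
     (\<forall>B. finite B \<and> B \<subseteq> tuples U Z \<longrightarrow>
        (\<exists>a \<in> tuples U X. B \<inter> D \<subseteq> fibre U Z \<phi> a \<and> B \<inter> D' \<subseteq> fibre U Z \<phi>' a))"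

definition honestly_finitely_separated ::
    "('f, 'r, 'u) struct \<Rightarrow> 'x set \<Rightarrow> 'z set \<Rightarrow>
     ('f, 'r, 'x + 'z) fo_formula \<Rightarrow> ('f, 'r, 'x + 'z) fo_formula \<Rightarrow>
     ('z \<Rightarrow> 'u) set \<Rightarrow> ('z \<Rightarrow> 'u) set \<Rightarrow> bool" where
  "honestly_finitely_separated U X Z \<phi> \<phi>' D D' \<longleftrightarrow>
     (\<forall>B. finite B \<and> B \<subseteq> tuples U Z \<longrightarrow>
        (\<exists>a \<in> tuples U X. B \<inter> D \<subseteq> fibre U Z \<phi> a \<and> B \<inter> D' \<subseteq> fibre U Z \<phi>' a \<and>
           D \<inter> fibre U Z \<phi>' a = {} \<and> D' \<inter> fibre U Z \<phi> a = {}))"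

text \<open>\<open>conj_upto m F\<close> is \<open>F 0 \<and> \<dots> \<and> F m\<close>, with upper bound included; likewise \<open>disj_upto\<close>.\<close>

primrec conj_upto :: "nat \<Rightarrow> (nat \<Rightarrow> ('f, 'r, 'v) fo_formula) \<Rightarrow> ('f, 'r, 'v) fo_formula" where
  "conj_upto 0 F = F 0"
| "conj_upto (Suc m) F = And (conj_upto m F) (F (Suc m))"

primrec disj_upto :: "nat \<Rightarrow> (nat \<Rightarrow> ('f, 'r, 'v) fo_formula) \<Rightarrow> ('f, 'r, 'v) fo_formula" where
  "disj_upto 0 F = F 0"
| "disj_upto (Suc m) F = Or (disj_upto m F) (F (Suc m))"

text \<open>The tuple of variables \<open>\<langle>x\<^sub>i\<^sub>,\<^sub>j\<rangle>\<close> is indexed by the triples \<open>(i, j, k)\<close> with \<open>k \<in> X\<close>, and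
  \<open>copy i j \<chi>\<close> is \<open>\<chi>(x\<^sub>i\<^sub>,\<^sub>j;z)\<close>.\<close>

definition grid :: "nat \<Rightarrow> nat \<Rightarrow> 'x set \<Rightarrow> (nat \<times> nat \<times> 'x) set" where
  "grid m n X = {..m} \<times> {..n} \<times> X"

definition copy ::
    "nat \<Rightarrow> nat \<Rightarrow> ('f, 'r, 'x + 'z) fo_formula \<Rightarrow> ('f, 'r, (nat \<times> nat \<times> 'x) + 'z) fo_formula" where
  "copy i j \<chi> = map_fo_formula id id (map_sum (\<lambda>k. (i, j, k)) id) \<chi>"

definition conj_disj ::
    "nat \<Rightarrow> nat \<Rightarrow> ('f, 'r, 'x + 'z) fo_formula \<Rightarrow> ('f, 'r, (nat \<times> nat \<times> 'x) + 'z) fo_formula" where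
  "conj_disj m n \<phi> = conj_upto m (\<lambda>i. disj_upto n (\<lambda>j. copy i j \<phi>))"

definition disj_conj ::
    "nat \<Rightarrow> nat \<Rightarrow> ('f, 'r, 'x + 'z) fo_formula \<Rightarrow> ('f, 'r, (nat \<times> nat \<times> 'x) + 'z) fo_formula" where
  "disj_conj m n \<phi> = disj_upto m (\<lambda>i. conj_upto n (\<lambda>j. copy i j \<phi>))"

lemma sat_conj_upto: "sat U v e (conj_upto m F) \<longleftrightarrow> (\<forall>i\<le>m. sat U v e (F i))"
  by (induction m) (auto simp: le_Suc_eq)

lemma sat_disj_upto: "sat U v e (disj_upto m F) \<longleftrightarrow> (\<exists>i\<le>m. sat U v e (F i))"
  by (induction m) (auto simp: le_Suc_eq)

lemma wf_conj_upto: "wf_formula L V k (conj_upto m F) \<longleftrightarrow> (\<forall>i\<le>m. wf_formula L V k (F i))"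
  by (induction m) (auto simp: le_Suc_eq)

lemma wf_disj_upto: "wf_formula L V k (disj_upto m F) \<longleftrightarrow> (\<forall>i\<le>m. wf_formula L V k (F i))"
  by (induction m) (auto simp: le_Suc_eq)

lemma term_val_map: "term_val U v e (map_fo_term id g t) = term_val U (v \<circ> g) e t"
  by (induction t) (auto simp: comp_def cong: map_cong)

lemma sat_map: "sat U v e (map_fo_formula id id g p) \<longleftrightarrow> sat U (v \<circ> g) e p"
  by (induction p arbitrary: e) (auto simp: term_val_map comp_def)

lemma wf_term_map: "wf_term L V k t \<Longrightarrow> g ` V \<subseteq> W \<Longrightarrow> wf_term L W k (map_fo_term id g t)"
  by (induction t) auto

lemma wf_formula_map:
  "wf_formula L V k p \<Longrightarrow> g ` V \<subseteq> W \<Longrightarrow> wf_formula L W k (map_fo_formula id id g p)"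
  by (induction p arbitrary: k) (auto simp: wf_term_map)

lemma holds_copy: "holds U (copy i j \<chi>) a b \<longleftrightarrow> holds U \<chi> (\<lambda>k. a (i, j, k)) b"
proof -
  have "case_sum a b \<circ> map_sum (\<lambda>k. (i, j, k)) id = case_sum (\<lambda>k. a (i, j, k)) b"
    by (auto simp: fun_eq_iff split: sum.split)
  then show ?thesis by (simp add: holds_def copy_def sat_map)
qed

lemma holds_conj_disj:
  "holds U (conj_disj m n \<phi>) a b \<longleftrightarrow> (\<forall>i\<le>m. \<exists>j\<le>n. holds U \<phi> (\<lambda>k. a (i, j, k)) b)"
  by (simp add: conj_disj_def holds_copy[symmetric]) (simp add: holds_def sat_conj_upto sat_disj_upto)

lemma holds_disj_conj:
  "holds U (disj_conj m n \<phi>) a b \<longleftrightarrow> (\<exists>i\<le>m. \<forall>j\<le>n. holds U \<phi> (\<lambda>k. a (i, j, k)) b)"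
  by (simp add: disj_conj_def holds_copy[symmetric]) (simp add: holds_def sat_conj_upto sat_disj_upto)

lemma is_formula_copy:
  assumes "is_formula L X Z \<phi>" "i \<le> m" "j \<le> n"
  shows "is_formula L (grid m n X) Z (copy i j \<phi>)"
  using assms unfolding is_formula_def copy_def
  by (intro wf_formula_map) (auto simp: grid_def)

lemma is_formula_conj_disj:
  "is_formula L X Z \<phi> \<Longrightarrow> is_formula L (grid m n X) Z (conj_disj m n \<phi>)"
  using is_formula_copy by (fastforce simp: is_formula_def conj_disj_def wf_conj_upto wf_disj_upto)

lemma is_formula_disj_conj:
  "is_formula L X Z \<phi> \<Longrightarrow> is_formula L (grid m n X) Z (disj_conj m n \<phi>)"
  using is_formula_copy by (fastforce simp: is_formula_def disj_conj_def wf_conj_upto wf_disj_upto)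

end

theory Submission
  imports Defs "HOL-Library.Ramsey"
begin

text \<open>
  Greedily choose parameters \<open>a\<^sub>0, a\<^sub>1, \<dots>\<close> that separate \<open>B\<close>: as long as some \<open>d\<^sub>k \<in> D\<close> satisfies
  \<open>\<phi>'(a\<^sub>i; d\<^sub>k)\<close> for all \<open>i \<le> k\<close>, let \<open>a\<^sub>k\<^sub>+\<^sub>1\<close> separate also \<open>d\<^sub>0, \<dots>, d\<^sub>k\<close>. Stable separation
  bounds the length of this process, which yields a tuple with \<open>D\<close> disjoint from
  \<open>\<And>\<^sub>j \<phi>'(a\<^sub>j; z)\<close>. The same process for \<open>D'\<close>, applied to \<open>\<Or>\<^sub>j \<phi>(x\<^sub>j; z)\<close> and
  \<open>\<And>\<^sub>j \<phi>'(x\<^sub>j; z)\<close> (again stably separated, by Ramsey's theorem), gives the remaining condition.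
\<close>

text \<open>The sequence excluded by stable separation, over arbitrary carriers: \<open>A\<close>
  may also consist of rows of parameters, and \<open>E\<close> may be \<open>D\<close> or
  \<open>D'\<close>.\<close>

definition ladder ::
    "'a set \<Rightarrow> 'b set \<Rightarrow> ('a \<Rightarrow> 'b \<Rightarrow> bool) \<Rightarrow> ('a \<Rightarrow> 'b \<Rightarrow> bool) \<Rightarrow> nat \<Rightarrow> bool" where
  "ladder A E P Q n \<longleftrightarrow>
     (\<exists>a b. (\<forall>i<n. a i \<in> A \<and> b i \<in> E) \<and> (\<forall>i j. i < j \<and> j < n \<longrightarrow> P (a i) (b j) \<and> Q (a j) (b i)))"

lemma ladderE:
  assumes "ladder A E P Q n"
  obtains a b where "\<And>i. i < n \<Longrightarrow> a i \<in> A \<and> b i \<in> E"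
    and "\<And>i j. i < j \<Longrightarrow> j < n \<Longrightarrow> P (a i) (b j) \<and> Q (a j) (b i)"
  using assms unfolding ladder_def by blast

lemma ladder_mono: "ladder A E P Q n \<Longrightarrow> E \<subseteq> F \<Longrightarrow> ladder A F P Q n"
  unfolding ladder_def by blast

text \<open>Reading both sequences backwards reverses i < j and so exchanges \<open>P\<close> and
  \<open>Q\<close>; \<open>n - Suc i\<close> is the reversed index.\<close>

lemma ladder_swap:
  assumes "ladder A E P Q n"
  shows "ladder A E Q P n"
proof -
  obtain a b where ab: "\<And>i. i < n \<Longrightarrow> a i \<in> A \<and> b i \<in> E"
    and PQ: "\<And>i j. i < j \<Longrightarrow> j < n \<Longrightarrow> P (a i) (b j) \<and> Q (a j) (b i)"
    using assms that by (rule ladderE)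
  have "Q (a (n - Suc i)) (b (n - Suc j)) \<and> P (a (n - Suc j)) (b (n - Suc i))"
    if "i < j" "j < n" for i j
    using that PQ[of "n - Suc j" "n - Suc i"] by auto
  moreover have "a (n - Suc i) \<in> A \<and> b (n - Suc i) \<in> E" if "i < n" for i
    using that ab[of "n - Suc i"] by auto
  ultimately show ?thesis
    unfolding ladder_def
    by (intro exI[of _ "\<lambda>i. a (n - Suc i)"] exI[of _ "\<lambda>i. b (n - Suc i)"]) blast
qed

text \<open>Colour each pair i < k by the index of a disjunct that is true at it. On a homogeneous
  set of colour j the components \<open>f i j\<close> form a ladder, since the conjunction gives
  \<open>Q\<close> at every index. So \<open>M\<close> is a Ramsey number for n + 1 colours, chosen
  before \<open>E\<close>, \<open>P\<close> and \<open>Q\<close>.\<close>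

lemma ladder_Ex_All:
  fixes A :: "'a set" and n N :: nat
  obtains M where "\<And>(E :: 'b set) P Q. ladder {f. \<forall>j\<le>n. f j \<in> A} E
      (\<lambda>f b. \<exists>j\<le>n. P (f j) b) (\<lambda>f b. \<forall>j\<le>n. Q (f j) b) M \<Longrightarrow> ladder A E P Q N"
proof -
  obtain M :: nat where M: "partn_lst {..<M} (replicate (Suc n) N) 2"
    using ramsey_full by blast
  have "ladder A E P Q N"
    if lad: "ladder {f. \<forall>j\<le>n. f j \<in> A} E
      (\<lambda>f b. \<exists>j\<le>n. P (f j) b) (\<lambda>f b. \<forall>j\<le>n. Q (f j) b) M" for E :: "'b set" and P Q
  proof -
    obtain f :: "nat \<Rightarrow> nat \<Rightarrow> 'a" and b
      where fb: "\<And>i. i < M \<Longrightarrow> f i \<in> {f. \<forall>j\<le>n. f j \<in> A} \<and> b i \<in> E"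
        and PQ: "\<And>i k. i < k \<Longrightarrow> k < M \<Longrightarrow>
          (\<exists>j\<le>n. P (f i j) (b k)) \<and> (\<forall>j\<le>n. Q (f k j) (b i))"
      using lad that by (rule ladderE)
    from PQ obtain c where c: "\<And>i k. i < k \<Longrightarrow> k < M \<Longrightarrow> c i k \<le> n \<and> P (f i (c i k)) (b k)"
      by metis
    \<comment> \<open>Ramsey's theorem colours two-element sets; \<open>Min\<close> and
      \<open>Max\<close> recover the order of the pair.\<close>
    define g where "g S = c (Min S) (Max S)" for S
    have g: "g {i, k} = c i k" if "i < k" for i k
      using that by (simp add: g_def)
    have "g \<in> nsets {..<M} 2 \<rightarrow> {..<Suc n}"
      using c by (auto simp: ordered_nsets_2_eq g less_Suc_eq_le)
    then obtain j H where j: "j < Suc n" and H: "H \<in> nsets {..<M} N"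
      and mono: "g ` nsets H 2 \<subseteq> {j}"
      using M by (elim partn_lstE) (auto simp del: replicate_Suc)
    have HM: "H \<subseteq> {..<M}" "finite H" "card H = N"
      using H by (auto simp: nsets_def)
    \<comment> \<open>Enumerating \<open>H\<close> increasingly preserves the order on which the
      ladder conditions depend.\<close>
    obtain h where h: "strict_mono_on {..<N} h" "h ` {..<N} = H"
    proof
      let ?l = "sorted_list_of_set H"
      show "strict_mono_on {..<N} ((!) ?l)"
        using HM strict_sorted_list_of_set[of H]
        by (auto simp: strict_mono_on_def sorted_wrt_iff_nth_less)
      show "(!) ?l ` {..<N} = H"
        using HM nth_image[of N ?l] by (simp add: atLeast0LessThan)
    qed
    have hM: "h i < M" "h i \<in> H" if "i < N" for i
      using that h HM by auto
    have "P (f (h i) j) (b (h k)) \<and> Q (f (h k) j) (b (h i))" if "i < k" "k < N" for i k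
    proof -
      have lt: "h i < h k"
        using h(1) that by (auto simp: strict_mono_on_def)
      have "{h i, h k} \<in> nsets H 2"
        using hM that lt by simp
      then have "c (h i) (h k) = j"
        using mono g[OF lt] by (metis image_subset_iff singletonD)
      then show ?thesis
        using c[OF lt hM(1)] PQ[OF lt hM(1)] j that by auto
    qed
    moreover have "f (h i) j \<in> A \<and> b (h i) \<in> E" if "i < N" for i
      using fb[OF hM(1)[OF that]] j by simp
    ultimately show ?thesis
      unfolding ladder_def by (intro exI[of _ "\<lambda>i. f (h i) j"] exI[of _ "\<lambda>i. b (h i)"]) blast
  qed
  then show ?thesis by (rule that)
qed

text \<open>Otherwise any N + 1 parameters good for \<open>B\<close> have a common
  \<open>Q\<close>-point in \<open>E\<close>, and a ladder of length N can be built step by step.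
  \<open>C B a\<close> abstracts "a separates B", so that the argument runs for single parameters
  against \<open>D\<close> and for rows of parameters against \<open>D'\<close>.\<close>

lemma greedy_avoidance:
  assumes no_ladder: "\<not> ladder A E Q P N"
    and sep: "\<And>B. finite B \<Longrightarrow> B \<subseteq> T \<Longrightarrow> \<exists>a\<in>A. C B a"
    and C_antimono: "\<And>B B' a. B \<subseteq> B' \<Longrightarrow> C B' a \<Longrightarrow> C B a"
    and C_P: "\<And>B a b. C B a \<Longrightarrow> b \<in> B \<inter> E \<Longrightarrow> P a b"
    and "E \<subseteq> T" "finite B" "B \<subseteq> T"
  shows "\<exists>a. (\<forall>i\<le>N. a i \<in> A \<and> C B (a i)) \<and> (\<forall>b\<in>E. \<exists>i\<le>N. \<not> Q (a i) b)"
proof (rule ccontr)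
  assume "\<not> ?thesis"
  then have next_b: "\<exists>b\<in>E. \<forall>i\<le>N. Q (a i) b" if "\<And>i. i \<le> N \<Longrightarrow> a i \<in> A \<and> C B (a i)" for a
    using that by blast
  have "\<exists>a b. (\<forall>i<k. a i \<in> A \<and> C B (a i) \<and> b i \<in> E) \<and>
      (\<forall>i j. i < j \<and> j < k \<longrightarrow> Q (a i) (b j) \<and> P (a j) (b i))" if "k \<le> N" for k
    using that
  proof (induction k)
    case 0
    then show ?case by simp
  next
    case (Suc k)
    then obtain a b where ab: "\<And>i. i < k \<Longrightarrow> a i \<in> A \<and> C B (a i) \<and> b i \<in> E"
      and QP: "\<And>i j. i < j \<Longrightarrow> j < k \<Longrightarrow> Q (a i) (b j) \<and> P (a j) (b i)"
      by (metis Suc_leD)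
    \<comment> \<open>Adding the earlier points to \<open>B\<close> forces the next parameter
      \<open>x\<close> to satisfy \<open>P\<close> at each of them.\<close>
    have "finite (B \<union> b ` {..<k})" "B \<union> b ` {..<k} \<subseteq> T"
      using assms(5-7) ab by auto
    then obtain x where x: "x \<in> A" "C (B \<union> b ` {..<k}) x"
      using sep by blast
    then have xB: "C B x"
      using C_antimono by blast
    have xP: "P x (b i)" if "i < k" for i
      using C_P[OF x(2)] ab that by auto
    \<comment> \<open>\<open>next_b\<close> speaks of N + 1 parameters, so the k old ones are padded
      with copies of \<open>x\<close>.\<close>
    have "\<exists>y\<in>E. \<forall>i\<le>N. Q (if i < k then a i else x) y"
      by (rule next_b) (simp add: ab x(1) xB)
    then obtain y where y: "y \<in> E" "\<And>i. i \<le> N \<Longrightarrow> Q (if i < k then a i else x) y"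
      by blast
    have Qy: "Q (a i) y" if "i < k" for i
      using y(2)[of i] that Suc.prems by simp
    show ?case
      using ab QP x(1) xB xP y(1) Qy
      by (intro exI[of _ "a(k := x)"] exI[of _ "b(k := y)"]) (auto simp: less_Suc_eq)
  qed
  then show False
    using no_ladder unfolding ladder_def by (metis order_refl)
qed

theorem theorem11p3:
  fixes L :: "('f, 'r) language" and U :: "('f, 'r, 'u) struct"
    and X :: "'x set" and Z :: "'z set"
    and \<phi> \<phi>' :: "('f, 'r, 'x + 'z) fo_formula"
    and D D' :: "('z \<Rightarrow> 'u) set"
  assumes "is_structure L U"
    and "finite X" and "finite Z"
    and "is_formula L X Z \<phi>" and "is_formula L X Z \<phi>'"
    and "stably_separated U X Z \<phi> \<phi>'"
    and "D \<subseteq> tuples U Z" and "D' \<subseteq> tuples U Z"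
    and "finitely_separated U X Z \<phi> \<phi>' D D'"
  shows "\<exists>m n. honestly_finitely_separated U (grid m n X) Z (conj_disj m n \<phi>) (disj_conj m n \<phi>') D D'"
proof -
  let ?A = "tuples U X" and ?T = "tuples U Z"
  define C where "C B a \<longleftrightarrow> (\<forall>b\<in>B \<inter> D. holds U \<phi> a b) \<and> (\<forall>b\<in>B \<inter> D'. holds U \<phi>' a b)" for B a
  have C_antimono: "C B a" if "B \<subseteq> B'" "C B' a" for B B' a
    using that unfolding C_def by blast
  have C_P: "holds U \<phi> a b" if "C B a" "b \<in> B \<inter> D" for B a b
    using that unfolding C_def by blast
  have sep: "\<exists>a\<in>?A. C B a" if "finite B" "B \<subseteq> ?T" for B
  proof -
    obtain a where "a \<in> ?A" "B \<inter> D \<subseteq> fibre U Z \<phi> a" "B \<inter> D' \<subseteq> fibre U Z \<phi>' a"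
      using assms(9) \<open>finite B\<close> \<open>B \<subseteq> ?T\<close> unfolding finitely_separated_def by metis
    then show ?thesis
      unfolding C_def fibre_def by blast
  qed
  obtain n where n: "\<not> ladder ?A ?T (holds U \<phi>) (holds U \<phi>') n"
    using assms(6) unfolding stably_separated_def ladder_def by blast
  let ?A\<^sub>n = "{f. \<forall>j\<le>n. f j \<in> ?A}"
  \<comment> \<open>\<open>K B f\<close> says that \<open>f\<close> can serve as a row of the grid;
    it replaces \<open>C\<close> in the second run.\<close>
  define K where "K B f \<longleftrightarrow> (\<forall>j\<le>n. C B (f j)) \<and> (\<forall>d\<in>D. \<exists>j\<le>n. \<not> holds U \<phi>' (f j) d)"
    for B and f :: "nat \<Rightarrow> 'x \<Rightarrow> 'u"
  \<comment> \<open>Avoiding \<phi>' on \<open>D\<close> makes \<phi>' the \<open>Q\<close> of the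
    greedy argument, the reverse of the order in stable separation.\<close>
  have "\<not> ladder ?A D (holds U \<phi>') (holds U \<phi>) n"
    using n ladder_swap ladder_mono assms(7) by blast
  then have "\<exists>f. (\<forall>j\<le>n. f j \<in> ?A \<and> C B (f j)) \<and> (\<forall>d\<in>D. \<exists>j\<le>n. \<not> holds U \<phi>' (f j) d)"
    if "finite B" "B \<subseteq> ?T" for B
    by (rule greedy_avoidance) (fact sep C_antimono C_P assms(7) that)+
  then have semi: "\<exists>f\<in>?A\<^sub>n. K B f" if "finite B" "B \<subseteq> ?T" for B
    using that unfolding K_def Bex_def mem_Collect_eq by metis
  \<comment> \<open>The same \<open>n\<close> gives the row length n + 1 and the forbidden ladder
    length; the Ramsey bound \<open>m\<close> gives m + 1 rows.\<close>
  obtain m where "ladder ?A\<^sub>n E (\<lambda>f b. \<exists>j\<le>n. P (f j) b) (\<lambda>f b. \<forall>j\<le>n. Q (f j) b) m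
      \<Longrightarrow> ladder ?A E P Q n" for E :: "('z \<Rightarrow> 'u) set" and P Q
    using ladder_Ex_All[of n ?A n] by blast
  then have m: "\<not> ladder ?A\<^sub>n D' (\<lambda>f b. \<exists>j\<le>n. holds U \<phi> (f j) b)
      (\<lambda>f b. \<forall>j\<le>n. holds U \<phi>' (f j) b) m"
    using n ladder_mono assms(8) by blast
  have K_antimono: "K B f" if "B \<subseteq> B'" "K B' f" for B B' f
    using that C_antimono unfolding K_def by blast
  have K_P: "\<forall>j\<le>n. holds U \<phi>' (f j) b" if "K B f" "b \<in> B \<inter> D'" for B f b
    using that unfolding K_def C_def by blast
  have "\<exists>a\<in>tuples U (grid m n X).
      B \<inter> D \<subseteq> fibre U Z (conj_disj m n \<phi>) a \<and> B \<inter> D' \<subseteq> fibre U Z (disj_conj m n \<phi>') a \<and>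
      D \<inter> fibre U Z (disj_conj m n \<phi>') a = {} \<and> D' \<inter> fibre U Z (conj_disj m n \<phi>) a = {}"
    if B: "finite B" "B \<subseteq> ?T" for B
  proof -
    have "\<exists>F. (\<forall>i\<le>m. F i \<in> ?A\<^sub>n \<and> K B (F i)) \<and>
        (\<forall>b\<in>D'. \<exists>i\<le>m. \<not> (\<exists>j\<le>n. holds U \<phi> (F i j) b))"
      using m by (rule greedy_avoidance) (fact semi K_antimono K_P assms(8) B)+
    then obtain F where F: "\<forall>i\<le>m. F i \<in> ?A\<^sub>n \<and> K B (F i)"
      and FD': "\<forall>b\<in>D'. \<exists>i\<le>m. \<not> (\<exists>j\<le>n. holds U \<phi> (F i j) b)"
      by (elim exE conjE) (rule that)
    \<comment> \<open>The default \<open>undefined\<close> makes \<open>a\<close> extensional; for k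
      outside \<open>X\<close> it is already the value of \<open>F i j\<close>.\<close>
    define a where "a = (\<lambda>(i, j, k). if i \<le> m \<and> j \<le> n then F i j k else undefined)"
    have col: "(\<lambda>k. a (i, j, k)) = F i j" if "i \<le> m" "j \<le> n" for i j
      using that by (simp add: a_def)
    have conj: "holds U (conj_disj m n \<phi>) a b \<longleftrightarrow> (\<forall>i\<le>m. \<exists>j\<le>n. holds U \<phi> (F i j) b)" for b
      by (simp add: holds_conj_disj col cong: conj_cong)
    have disj: "holds U (disj_conj m n \<phi>') a b \<longleftrightarrow> (\<exists>i\<le>m. \<forall>j\<le>n. holds U \<phi>' (F i j) b)" for b
      by (simp add: holds_disj_conj col cong: conj_cong)
    show ?thesis
    proof (intro bexI conjI)
      show "a \<in> tuples U (grid m n X)"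
        using F by (force simp: a_def tuples_def grid_def PiE_iff extensional_def)
      \<comment> \<open>Every entry of every row separates \<open>B\<close>, so column 0 is a
        witness here, and row 0 is one for \<open>disj_conj\<close> below.\<close>
      have "\<exists>j\<le>n. holds U \<phi> (F i j) b" if "b \<in> B \<inter> D" "i \<le> m" for b i
        using F that unfolding K_def C_def by (meson le0)
      then show "B \<inter> D \<subseteq> fibre U Z (conj_disj m n \<phi>) a"
        using B(2) by (auto simp: fibre_def conj)
      have "\<forall>j\<le>n. holds U \<phi>' (F 0 j) b" if "b \<in> B \<inter> D'" for b
        using F K_P[OF _ that] by simp
      then show "B \<inter> D' \<subseteq> fibre U Z (disj_conj m n \<phi>') a"
        using B(2) by (auto simp: fibre_def disj)
      \<comment> \<open>The first run made each single row avoid \<open>D\<close>; avoiding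
        \<open>D'\<close> takes all rows together, by the second run.\<close>
      have "\<exists>j\<le>n. \<not> holds U \<phi>' (F i j) b" if "b \<in> D" "i \<le> m" for b i
        using F that unfolding K_def by simp
      then show "D \<inter> fibre U Z (disj_conj m n \<phi>') a = {}"
        by (fastforce simp: fibre_def disj)
      show "D' \<inter> fibre U Z (conj_disj m n \<phi>) a = {}"
        using FD' by (fastforce simp: fibre_def conj)
    qed
  qed
  then show ?thesis
    unfolding honestly_finitely_separated_def by (intro exI[of _ m] exI[of _ n]) simp
qed

end
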